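(* Let $A$ be any algorithm with the following properties: $A$ is given $N$, an accuracy parameter $\epsilon>0$, a value $0<a_{\max}\in\mathbb{Z}$, and access to i.i.d. draws from an unknown distribution $\mathbf{S}=a_2\mathbf{S}_2+a_3\mathbf{S}_3$, where $\mathbf{S}_2,\mathbf{S}_3$ are independent PBD$_N$ distributions, $a_3$ is the largest prime that is at most $a_{\max}$, and $0<a_2<a_3$ (the values $a_1=0$ and $a_3$ are known to $A$, but $a_2$ is not). Suppose that $A$ is guaranteed to output, with probability at least $9/10$, a hypothesis distribution $\tilde{\mathbf{S}}$ satisfying $d_{TV}(\mathbf{S},\tilde{\mathbf{S}})\le\epsilon$. Then for sufficiently large $N$, $A$ must use $\Omega(\log a_{\max})$ samples even when run with $\epsilon$ set to a (suitably small) positive absolute constant.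
   Context: A PBD$_N$ is a sum of $N$ mutually independent (not necessarily identical) Bernoulli random variables. $d_{TV}$ denotes total variation distance. *)

theory Defs
  imports "HOL-Probability.Probability"
begin

definition pbd :: "nat \<Rightarrow> (nat \<Rightarrow> real) \<Rightarrow> nat pmf" where
  "pbd N p = map_pmf (\<lambda>f. card {i \<in> {..<N}. f i})
                     (Pi_pmf {..<N} False (\<lambda>i. bernoulli_pmf (p i)))"

definition dtv :: "int pmf \<Rightarrow> int pmf \<Rightarrow> real" where
  "dtv P Q = (SUP A. \<bar>measure_pmf.prob P A - measure_pmf.prob Q A\<bar>)"

definition largest_prime_le :: "nat \<Rightarrow> nat" where
  "largest_prime_le a = Max {p. prime p \<and> p \<le> a}"

definition weighted_pbd_sum :: "nat \<Rightarrow> nat \<Rightarrow> nat \<Rightarrow> (nat \<Rightarrow> real) \<Rightarrow> (nat \<Rightarrow> real) \<Rightarrow> int pmf" where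
  "weighted_pbd_sum N a2 a3 p q =
     do { x \<leftarrow> pbd N p; y \<leftarrow> pbd N q; return_pmf (int a2 * int x + int a3 * int y) }"

text \<open>An algorithm drawing m i.i.d. samples (stored at indices 0..m-1) and outputting
  a (possibly randomized) hypothesis distribution. It succeeds on the class
  (parameters N, a_max, accuracy eps) if for every admissible target S it outputs,
  with probability at least 9/10, a hypothesis within eps of S in total variation.\<close>
definition learns :: "nat \<Rightarrow> nat \<Rightarrow> real \<Rightarrow> nat \<Rightarrow> ((nat \<Rightarrow> int) \<Rightarrow> int pmf pmf) \<Rightarrow> bool" where
  "learns N amax eps m A \<longleftrightarrow>
     (\<forall>a2 p q. 0 < a2 \<and> a2 < largest_prime_le amax
        \<and> (\<forall>i<N. 0 \<le> p i \<and> p i \<le> 1) \<and> (\<forall>i<N. 0 \<le> q i \<and> q i \<le> 1) \<longrightarrow>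
        (let S = weighted_pbd_sum N a2 (largest_prime_le amax) p q in
           measure_pmf.prob (Pi_pmf {..<m} 0 (\<lambda>_. S) \<bind> A) {H. dtv S H \<le> eps} \<ge> 9/10))"

end

theory Submission
  imports Defs
begin

text \<open>
  Let \<open>a\<close> be the largest prime up to \<open>a_max\<close>, let \<open>X\<close> be binomial with parameters \<open>n \<approx> a\<^sup>2 / 16\<close> and
  \<open>1/2\<close>, let \<open>Y\<close> be binomial with parameters \<open>N\<close> and \<open>1/2\<close>, and consider the targets
  \<open>S\<^sub>b = b X + a Y\<close> for \<open>0 < b < a\<close>. The standard deviation of \<open>X\<close> is of order \<open>a\<close>, so every residue
  class modulo \<open>a\<close> has mass \<open>O(1/a)\<close> under \<open>b X\<close>; since \<open>Y\<close> is very flat for large \<open>N\<close>, all \<open>S\<^sub>b\<close> are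
  pointwise at most \<open>18 Q\<close> for one distribution \<open>Q\<close>. Hence \<open>m\<close> samples of \<open>S\<^sub>b\<close> can be replaced by
  samples of \<open>Q\<close>, which carry no information on \<open>b\<close>, while losing only a factor \<open>18 ^ m\<close> in the success
  probability.

  On the other hand the Fourier coefficient of \<open>S\<^sub>b\<close> modulo \<open>a\<close> at \<open>b\<^sup>-\<^sup>1\<close> has modulus at least \<open>1/2\<close>,
  and by Parseval each \<open>S\<^sub>b\<close> has a bounded number of large coefficients. So any hypothesis is close to
  at most \<open>144\<close> of the \<open>S\<^sub>b\<close>, which gives \<open>(9/10) (a - 1) \<le> 144 \<cdot> 18 ^ m\<close>.

  Finally \<open>a\<close> is at least \<open>\<surd>a_max / 8\<close>: this weak form of Chebyshev's bound suffices because only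
  \<open>ln a\<close> matters, and it follows from \<open>2 ^ (k - 1) \<le> lcm(1, \<dots>, k) \<le> k ^ \<pi>(k)\<close>.
\<close>

subsection \<open>A lower bound for the largest prime\<close>

text \<open>The numbers \<open>1 / (Suc n * (n choose k))\<close> form Leibniz's harmonic triangle:
  each is an entry of the previous row minus its left neighbour. Induction over the columns thus
  reduces all of them to integer combinations of \<open>1 / i\<close>, which become integers after
  multiplication by \<open>D\<close>.\<close>

lemma leibniz_triangle_dvd:
  fixes D N n k :: nat
  assumes D: "\<And>i. i \<in> {1..N} \<Longrightarrow> i dvd D" and "k \<le> n" "n < N"
  shows "Suc n * (n choose k) dvd D"
proof -
  have "real D / (real (Suc n) * real (n choose k)) \<in> \<int>"
    using assms(2,3)
  proof (induction k arbitrary: n)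
    case 0
    then have "Suc n dvd D" by (intro D) auto
    then obtain j where "D = Suc n * j" by (elim dvdE)
    then have "real D / (real (Suc n) * real (n choose 0)) = real j"
      by (simp only: of_nat_mult binomial_n_0) simp
    then show ?case by simp
  next
    case (Suc k)
    then obtain l where l: "n = Suc l" "k \<le> l" by (cases n) auto
    have c1: "real (Suc k) * real (n choose Suc k) = real (n - k) * real (n choose k)"
      using binomial_absorb_comp[of n k] Suc.prems(1)
      by (metis binomial_absorption l(1) of_nat_mult diff_Suc_1)
    have c2: "real n * real (l choose k) = real (n - k) * real (n choose k)"
      using binomial_absorb_comp[of n k] l by (metis of_nat_mult diff_Suc_1)
    have pos: "real (n choose k) > 0" "real (n - k) > 0" "real (n choose Suc k) > 0"
      using Suc.prems(1) by simp_all
    have nk: "real (n - k) = real n - real k" using Suc.prems(1) by simp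
    have "real D / (real (Suc n) * real (n choose Suc k))
        = real D * real (Suc k) / (real (Suc n) * (real (n - k) * real (n choose k)))"
      unfolding c1[symmetric] using pos by simp
    also have "\<dots> = real D / (real (n - k) * real (n choose k)) - real D / (real (Suc n) * real (n choose k))"
    proof -
      have "d * s / ((m + s) * (m * c)) = d / (m * c) - d / ((m + s) * c)"
        if "m > 0" "s > 0" "c > 0" for d s m c :: real
      proof -
        have "m + s > 0" using that by simp
        then show ?thesis using that by (simp add: divide_simps) (simp add: algebra_simps)
      qed
      from this[of "real (n - k)" "real (Suc k)" "real (n choose k)" "real D"] show ?thesis
        using pos nk by (simp add: algebra_simps)
    qed
    also have "\<dots> = real D / (real (Suc l) * real (l choose k)) - real D / (real (Suc n) * real (n choose k))"
      using c2 l by simp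
    also have "\<dots> \<in> \<int>"
      using Suc.IH[of l] Suc.IH[of n] Suc.prems l by (intro Ints_diff) auto
    finally show ?case .
  qed
  then obtain z :: int where z: "real D / (real (Suc n) * real (n choose k)) = of_int z"
    by (auto elim: Ints_cases)
  have "real (n choose k) > 0" using assms by simp
  then have "real D = of_int z * (real (Suc n) * real (n choose k))"
    using z[symmetric] by (simp del: of_nat_Suc)
  then have "int D = z * int (Suc n * (n choose k))"
    by (metis of_int_eq_iff of_int_mult of_int_of_nat_eq of_nat_mult)
  then have "int (Suc n * (n choose k)) dvd int D" by simp
  then show ?thesis by (simp only: of_nat_dvd_iff)
qed

text \<open>Apply the divisibility to the central coefficient: \<open>Suc n\<close> times the
  largest entry of row \<open>n\<close> of Pascal's triangle is at least the row sum.\<close>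

lemma two_power_le_common_multiple:
  fixes D n :: nat
  assumes "\<And>i. i \<in> {1..Suc n} \<Longrightarrow> i dvd D" "D > 0"
  shows "2 ^ n \<le> D"
proof -
  have "2 ^ n = (\<Sum>k\<le>n. n choose k)" by (simp add: choose_row_sum)
  also have "\<dots> \<le> (\<Sum>k\<le>n. n choose (n div 2))" by (intro sum_mono binomial_maximum)
  also have "\<dots> = Suc n * (n choose (n div 2))" by simp
  also have "\<dots> \<le> D"
    using leibniz_triangle_dvd[of "Suc n" D "n div 2" n] assms by (intro dvd_imp_le) auto
  finally show ?thesis .
qed

text \<open>The \<open>D\<close> below is the least common multiple of \<open>1..Suc n\<close>,
  written as a product of prime powers. Each factor \<open>p ^ v p\<close> divides some
  \<open>i\<close> in this range, so it is at most \<open>Suc n\<close>.\<close>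

lemma two_power_le_power_card_primes:
  "2 ^ n \<le> Suc n ^ card {p. prime p \<and> p \<le> Suc n}"
proof -
  let ?P = "{p. prime p \<and> p \<le> Suc n}"
  define v where "v p = Max ((\<lambda>i. multiplicity p i) ` {1..Suc n})" for p :: nat
  define D where "D = (\<Prod>p\<in>?P. p ^ v p)"
  have fin: "finite ?P" by simp
  have Dpos: "D > 0" unfolding D_def by (intro prod_pos) (auto dest: prime_gt_0_nat)
  have dvd: "i dvd D" if i: "i \<in> {1..Suc n}" for i
  proof (rule multiplicity_le_imp_dvd)
    fix p :: nat assume p: "prime p"
    show "multiplicity p i \<le> multiplicity p D"
    proof (cases "p dvd i")
      case True
      then have "p \<in> ?P" using p i by (auto dest!: dvd_imp_le)
      then have "multiplicity p D = v p"
        unfolding D_def using p fin by (subst multiplicity_prod_prime_powers) auto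
      moreover have "multiplicity p i \<le> v p" unfolding v_def using i by (intro Max_ge) auto
      ultimately show ?thesis by simp
    qed (simp add: not_dvd_imp_multiplicity_0)
  qed (use i in auto)
  have "2 ^ n \<le> D" using two_power_le_common_multiple dvd Dpos by blast
  also have "D \<le> (\<Prod>p\<in>?P. Suc n)"
    unfolding D_def
  proof (intro prod_mono conjI)
    fix p assume "p \<in> ?P"
    have "v p \<in> (\<lambda>i. multiplicity p i) ` {1..Suc n}" unfolding v_def by (intro Max_in) auto
    then obtain i where i: "i \<in> {1..Suc n}" "v p = multiplicity p i" by auto
    have "p ^ v p \<le> i" unfolding i(2) using i(1) by (intro dvd_imp_le multiplicity_dvd) auto
    then show "p ^ v p \<le> Suc n" using i by simp
  qed simp
  finally show ?thesis by simp
qed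

lemma largest_prime_le:
  assumes "n \<ge> 2"
  shows prime_largest_prime_le: "prime (largest_prime_le n)"
    and largest_prime_le_ge: "\<And>p. prime p \<Longrightarrow> p \<le> n \<Longrightarrow> p \<le> largest_prime_le n"
proof -
  have "2 \<in> {p. prime p \<and> p \<le> n}" using assms two_is_prime_nat by simp
  then have "largest_prime_le n \<in> {p. prime p \<and> p \<le> n}"
    unfolding largest_prime_le_def by (intro Max_in) (simp, blast)
  then show "prime (largest_prime_le n)" by simp
  show "\<And>p. prime p \<Longrightarrow> p \<le> n \<Longrightarrow> p \<le> largest_prime_le n"
    unfolding largest_prime_le_def by (intro Max_ge) auto
qed

text \<open>Counting the primes up to \<open>n\<close> by the crude bound \<open>?a\<close> gives
  \<open>2 ^ (n - 1) \<le> n ^ ?a\<close>; then take logarithms.\<close>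

lemma largest_prime_le_ge_sqrt:
  assumes "n \<ge> 2"
  shows "sqrt (real n) / 8 \<le> real (largest_prime_le n)"
proof -
  let ?a = "largest_prime_le n"
  from assms obtain l where l: "n = Suc l" by (cases n) auto
  have "{p. prime p \<and> p \<le> n} \<subseteq> {1..?a}"
    using largest_prime_le_ge[OF assms] by (auto simp: Suc_le_eq dest: prime_gt_0_nat)
  then have "card {p. prime p \<and> p \<le> n} \<le> card {1..?a}" by (intro card_mono) auto
  then have c: "card {p. prime p \<and> p \<le> n} \<le> ?a" by simp
  have "2 ^ l \<le> n ^ card {p. prime p \<and> p \<le> n}"
    using two_power_le_power_card_primes[of l] l by simp
  also have "\<dots> \<le> n ^ ?a" using assms c by (intro power_increasing) auto
  finally have "(2::real) ^ l \<le> real n ^ ?a" by (metis of_nat_le_iff of_nat_numeral of_nat_power)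
  then have "ln ((2::real) ^ l) \<le> ln (real n ^ ?a)" using assms by (subst ln_le_cancel_iff) auto
  then have 1: "real l * ln 2 \<le> real ?a * ln (real n)" using assms by (simp add: ln_realpow)
  have s: "sqrt (real n) > 0" "real n = sqrt (real n) * sqrt (real n)" using assms by simp_all
  \<comment> \<open>Using \<open>ln x \<le> x - 1\<close> at the square root instead of at
    \<open>n\<close> itself leaves a factor of order \<open>sqrt n\<close>.\<close>
  have "ln (real n) = 2 * ln (sqrt (real n))" using assms by (simp add: ln_sqrt)
  also have "\<dots> \<le> 2 * sqrt (real n)" using ln_le_minus_one[OF s(1)] by simp
  finally have 2: "real ?a * ln (real n) \<le> real ?a * (2 * sqrt (real n))"
    by (intro mult_left_mono) auto
  have "real n / 2 * (1 / 2) \<le> real l * ln 2"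
    using l assms ln2_ge_two_thirds by (intro mult_mono) auto
  then have "sqrt (real n) * sqrt (real n) \<le> 8 * real ?a * sqrt (real n)"
    using 1 2 s(2) by linarith
  then have "sqrt (real n) \<le> 8 * real ?a" using s(1) by (simp only: mult_le_cancel_right_pos)
  then show ?thesis by simp
qed

subsection \<open>Total variation distance and domination\<close>

lemma abs_prob_diff_le_dtv:
  "\<bar>measure_pmf.prob P A - measure_pmf.prob Q A\<bar> \<le> dtv P Q"
  unfolding dtv_def
proof (rule cSUP_upper)
  show "bdd_above (range (\<lambda>A. \<bar>measure_pmf.prob P A - measure_pmf.prob Q A\<bar>))"
  proof (rule bdd_aboveI2)
    fix A
    show "\<bar>measure_pmf.prob P A - measure_pmf.prob Q A\<bar> \<le> 1"
      using measure_pmf.prob_le_1[of P A] measure_pmf.prob_le_1[of Q A]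
        measure_nonneg[of P A] measure_nonneg[of Q A] by linarith
  qed
qed simp

lemma dtv_triangle:
  assumes "dtv P H \<le> e" "dtv Q H \<le> e"
  shows "dtv P Q \<le> 2 * e"
  unfolding dtv_def
proof (rule cSUP_least)
  fix A
  show "\<bar>measure_pmf.prob P A - measure_pmf.prob Q A\<bar> \<le> 2 * e"
    using abs_prob_diff_le_dtv[of P A H] abs_prob_diff_le_dtv[of Q A H] assms by linarith
qed simp

text \<open>Split \<open>F\<close> by the sign of the difference; on each half the sum is the
  discrepancy of a single event.\<close>

lemma sum_abs_pmf_diff_le_dtv:
  assumes "finite F"
  shows "(\<Sum>x\<in>F. \<bar>pmf P x - pmf Q x\<bar>) \<le> 2 * dtv P Q"
proof -
  let ?G = "{x\<in>F. pmf P x \<ge> pmf Q x}" and ?L = "{x\<in>F. \<not> pmf P x \<ge> pmf Q x}"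
  have "(\<Sum>x\<in>F. \<bar>pmf P x - pmf Q x\<bar>)
      = (\<Sum>x\<in>?G. \<bar>pmf P x - pmf Q x\<bar>) + (\<Sum>x\<in>?L. \<bar>pmf P x - pmf Q x\<bar>)"
  proof -
    have "F = ?G \<union> ?L" by blast
    moreover have "?G \<inter> ?L = {}" by blast
    ultimately show ?thesis
      using assms sum.union_disjoint[of ?G ?L "\<lambda>x. \<bar>pmf P x - pmf Q x\<bar>"] by simp
  qed
  also have "(\<Sum>x\<in>?G. \<bar>pmf P x - pmf Q x\<bar>) = (\<Sum>x\<in>?G. pmf P x) - (\<Sum>x\<in>?G. pmf Q x)"
    by (subst sum_subtractf[symmetric]) (auto intro!: sum.cong)
  also have "(\<Sum>x\<in>?L. \<bar>pmf P x - pmf Q x\<bar>) = (\<Sum>x\<in>?L. pmf Q x) - (\<Sum>x\<in>?L. pmf P x)"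
    by (subst sum_subtractf[symmetric]) (auto intro!: sum.cong)
  finally show ?thesis
    using assms abs_prob_diff_le_dtv[of P ?G Q] abs_prob_diff_le_dtv[of P ?L Q]
    by (simp add: measure_measure_pmf_finite)
qed

text \<open>Applied to characters, this turns closeness in total variation into closeness of Fourier
  coefficients.\<close>

lemma norm_sum_pmf_diff_le_dtv:
  fixes f :: "int \<Rightarrow> complex"
  assumes "finite F" "\<And>x. norm (f x) \<le> 1"
  shows "norm ((\<Sum>x\<in>F. of_real (pmf P x) * f x) - (\<Sum>x\<in>F. of_real (pmf Q x) * f x)) \<le> 2 * dtv P Q"
proof -
  have "norm ((\<Sum>x\<in>F. of_real (pmf P x) * f x) - (\<Sum>x\<in>F. of_real (pmf Q x) * f x))
      = norm (\<Sum>x\<in>F. of_real (pmf P x - pmf Q x) * f x)"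
    by (simp add: sum_subtractf algebra_simps)
  also have "\<dots> \<le> (\<Sum>x\<in>F. \<bar>pmf P x - pmf Q x\<bar>)"
  proof (rule sum_norm_le)
    fix x
    show "norm (of_real (pmf P x - pmf Q x) * f x) \<le> \<bar>pmf P x - pmf Q x\<bar>"
      using assms(2)[of x] by (simp only: norm_mult norm_of_real mult_left_le abs_ge_zero)
  qed
  finally show ?thesis using sum_abs_pmf_diff_le_dtv[OF assms(1), of P Q] by linarith
qed

lemma prob_bind_pmf_le_of_pmf_le:
  fixes A :: "'a \<Rightarrow> 'b pmf"
  assumes "\<And>x. pmf P x \<le> c * pmf Q x" "c \<ge> 0"
  shows "measure_pmf.prob (P \<bind> A) E \<le> c * measure_pmf.prob (Q \<bind> A) E"
proof -
  have "emeasure (measure_pmf (P \<bind> A)) E = (\<integral>\<^sup>+x. ennreal (pmf P x) * emeasure (A x) E \<partial>count_space UNIV)"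
    by (simp add: nn_integral_measure_pmf)
  also have "\<dots> \<le> (\<integral>\<^sup>+x. ennreal c * (ennreal (pmf Q x) * emeasure (A x) E) \<partial>count_space UNIV)"
  proof (rule nn_integral_mono)
    fix x
    have "ennreal (pmf P x) \<le> ennreal c * ennreal (pmf Q x)"
      using assms by (subst ennreal_mult[symmetric]) (auto intro: ennreal_leI)
    then show "ennreal (pmf P x) * emeasure (A x) E \<le> ennreal c * (ennreal (pmf Q x) * emeasure (A x) E)"
      by (subst mult.assoc[symmetric]) (rule mult_right_mono, auto)
  qed
  also have "\<dots> = ennreal c * emeasure (measure_pmf (Q \<bind> A)) E"
    by (subst nn_integral_cmult) (simp_all add: nn_integral_measure_pmf)
  finally show ?thesis
    using assms(2) by (simp add: measure_pmf.emeasure_eq_measure ennreal_mult[symmetric] del: emeasure_bind_pmf)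
qed

lemma pmf_Pi_pmf_le_of_pmf_le:
  assumes "\<And>x. pmf P x \<le> c * pmf Q x" "finite I"
  shows "pmf (Pi_pmf I d (\<lambda>_. P)) f \<le> c ^ card I * pmf (Pi_pmf I d (\<lambda>_. Q)) f"
proof -
  have "(\<Prod>i\<in>I. pmf P (f i)) \<le> (\<Prod>i\<in>I. c * pmf Q (f i))"
    by (intro prod_mono) (auto simp: assms)
  then show ?thesis using assms(2) by (auto simp: pmf_Pi prod.distrib)
qed

text \<open>\<open>Q\<close> is the envelope \<open>w\<close> restricted to the union
  \<open>F\<close> of the supports and normalised. Its mass \<open>W\<close> is at least 1 because
  \<open>w\<close> dominates a probability law, and at most \<open>D\<close>.\<close>

lemma ex_dominating_pmf:
  fixes S :: "'b \<Rightarrow> 'a pmf" and w :: "'a \<Rightarrow> real"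
  assumes "finite B" "B \<noteq> {}" and fin: "\<And>b. b \<in> B \<Longrightarrow> finite (set_pmf (S b))"
    and w: "\<And>b x. b \<in> B \<Longrightarrow> pmf (S b) x \<le> w x"
    and D: "\<And>F. finite F \<Longrightarrow> sum w F \<le> D"
  shows "\<exists>Q. \<forall>b\<in>B. \<forall>x. pmf (S b) x \<le> D * pmf Q x"
proof -
  define F where "F = (\<Union>b\<in>B. set_pmf (S b))"
  define W where "W = sum w F"
  have finF: "finite F" unfolding F_def using assms by auto
  obtain b0 where b0: "b0 \<in> B" using assms(2) by auto
  have w0: "w x \<ge> 0" for x using w[OF b0, of x] pmf_nonneg[of "S b0" x] by linarith
  have "1 = (\<Sum>x\<in>F. pmf (S b0) x)"
    using sum_pmf_eq_1[OF finF] b0 unfolding F_def by fastforce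
  also have "\<dots> \<le> W" unfolding W_def by (intro sum_mono w b0)
  finally have W: "W \<ge> 1" .
  have WD: "W \<le> D" unfolding W_def by (intro D finF)
  define f where "f x = (if x \<in> F then w x / W else 0)" for x
  have f0: "f x \<ge> 0" for x using w0[of x] W by (simp add: f_def)
  have "(\<integral>\<^sup>+x. ennreal (f x) \<partial>count_space UNIV) = (\<Sum>x\<in>F. ennreal (f x))"
    using finF by (intro nn_integral_count_space'[of F]) (auto simp: f_def)
  also have "\<dots> = ennreal (\<Sum>x\<in>F. f x)" using f0 by (intro sum_ennreal) auto
  also have "(\<Sum>x\<in>F. f x) = 1"
    using W by (simp add: f_def sum_divide_distrib[symmetric] W_def[symmetric])
  finally have f1: "(\<integral>\<^sup>+x. ennreal (f x) \<partial>count_space UNIV) = 1" by simp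
  have "pmf (S b) x \<le> D * pmf (embed_pmf f) x" if b: "b \<in> B" for b x
  proof (cases "x \<in> F")
    case True
    have "pmf (S b) x \<le> W * f x" using w[OF b, of x] W True by (simp add: f_def)
    also have "\<dots> \<le> D * f x" using WD f0 by (rule mult_right_mono)
    finally show ?thesis by (simp add: pmf_embed_pmf[OF f0 f1])
  next
    case False
    then have "pmf (S b) x = 0" using b by (auto simp: F_def set_pmf_iff)
    then show ?thesis using W WD f0 by (simp add: pmf_embed_pmf[OF f0 f1])
  qed
  then show ?thesis by blast
qed

text \<open>Double counting: the left side is the expected number of \<open>b\<close> whose event
  contains the random output.\<close>

lemma sum_prob_le_multiplicity:
  fixes R :: "'a pmf"
  assumes "finite B" "\<And>H. card {b\<in>B. H \<in> E b} \<le> L"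
  shows "(\<Sum>b\<in>B. measure_pmf.prob R (E b)) \<le> real L"
proof -
  have "(\<Sum>b\<in>B. measure_pmf.prob R (E b)) = (\<Sum>b\<in>B. measure_pmf.expectation R (indicator (E b)))"
    by simp
  also have "\<dots> = measure_pmf.expectation R (\<lambda>H. \<Sum>b\<in>B. indicator (E b) H)"
    by (subst Bochner_Integration.integral_sum) (auto simp: measure_pmf.emeasure_eq_measure)
  also have "\<dots> \<le> measure_pmf.expectation R (\<lambda>H. real L)"
  proof (rule integral_mono)
    fix H
    have "(\<Sum>b\<in>B. indicator (E b) H) = real (card {b\<in>B. H \<in> E b})"
      using assms(1) by (simp add: indicator_def sum.If_cases Int_def)
    then show "(\<Sum>b\<in>B. indicator (E b) H) \<le> real L" using assms(2) by simp
  qed (auto intro!: Bochner_Integration.integrable_sum simp: measure_pmf.emeasure_eq_measure)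
  finally show ?thesis by simp
qed

text \<open>Averaging over the targets: the samples can be replaced by samples from \<open>Q\<close> at the cost of
  a factor \<open>D ^ m\<close>, and the output on \<open>Q\<close> is a good answer for at most \<open>L\<close> targets.\<close>
lemma card_targets_le:
  fixes S :: "'b \<Rightarrow> int pmf" and A :: "(nat \<Rightarrow> int) \<Rightarrow> int pmf pmf"
  assumes "finite B" "D \<ge> 0"
    and dom: "\<And>b x. b \<in> B \<Longrightarrow> pmf (S b) x \<le> D * pmf Q x"
    and pack: "\<And>b0. b0 \<in> B \<Longrightarrow> card {b\<in>B. dtv (S b) (S b0) \<le> 2 * e} \<le> L"
    and succ: "\<And>b. b \<in> B \<Longrightarrow>
      measure_pmf.prob (Pi_pmf {..<m} 0 (\<lambda>_. S b) \<bind> A) {H. dtv (S b) H \<le> e} \<ge> r"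
  shows "r * real (card B) \<le> D ^ m * real L"
proof -
  define R where "R = Pi_pmf {..<m} 0 (\<lambda>_. Q) \<bind> A"
  have mult: "card {b\<in>B. H \<in> {H. dtv (S b) H \<le> e}} \<le> L" for H
  proof (cases "{b\<in>B. dtv (S b) H \<le> e} = {}")
    case True
    then show ?thesis by (simp only: mem_Collect_eq card.empty le0)
  next
    case False
    then obtain b0 where b0: "b0 \<in> B" "dtv (S b0) H \<le> e" by auto
    \<comment> \<open>All targets close to \<open>H\<close> lie within \<open>2 * e\<close> of one
      of them, \<open>b0\<close>, so \<open>pack\<close> applies although \<open>H\<close> is
      arbitrary.\<close>
    have "card {b\<in>B. H \<in> {H. dtv (S b) H \<le> e}} \<le> card {b\<in>B. dtv (S b) (S b0) \<le> 2 * e}"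
      using assms(1) b0 by (intro card_mono) (auto intro: dtv_triangle)
    then show ?thesis using pack[OF b0(1)] by linarith
  qed
  have "r * real (card B) = (\<Sum>b\<in>B. r)" by simp
  also have "\<dots> \<le> (\<Sum>b\<in>B. D ^ m * measure_pmf.prob R {H. dtv (S b) H \<le> e})"
  proof (rule sum_mono)
    fix b assume b: "b \<in> B"
    have "r \<le> measure_pmf.prob (Pi_pmf {..<m} 0 (\<lambda>_. S b) \<bind> A) {H. dtv (S b) H \<le> e}"
      using succ b .
    also have "\<dots> \<le> D ^ m * measure_pmf.prob R {H. dtv (S b) H \<le> e}"
      unfolding R_def
      using pmf_Pi_pmf_le_of_pmf_le[of "S b" D Q "{..<m}" 0] dom[OF b] assms(2)
      by (intro prob_bind_pmf_le_of_pmf_le) auto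
    finally show "r \<le> D ^ m * measure_pmf.prob R {H. dtv (S b) H \<le> e}" .
  qed
  also have "\<dots> = D ^ m * (\<Sum>b\<in>B. measure_pmf.prob R {H. dtv (S b) H \<le> e})"
    by (simp add: sum_distrib_left)
  also have "\<dots> \<le> D ^ m * real L"
    using assms(1,2) mult by (intro mult_left_mono sum_prob_le_multiplicity) auto
  finally show ?thesis .
qed

subsection \<open>Smoothness of symmetric binomial laws\<close>

text \<open>Extended by 0 to all integers (above \<open>n\<close> the binomial coefficient
  vanishes), so that shifts and residue classes need no boundary cases.\<close>

definition half_binom :: "nat \<Rightarrow> int \<Rightarrow> real" where
  "half_binom n t = (if t < 0 then 0 else real (n choose nat t) / 2 ^ n)"

lemma half_binom_nonneg: "half_binom n t \<ge> 0"
  by (simp add: half_binom_def)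

text \<open>The known Bernstein sums then supply the total mass and the first two factorial
  moments.\<close>

lemma half_binom_of_nat: "half_binom n (int k) = Bernstein n k (1 / 2)"
proof (cases "k \<le> n")
  case True
  then have "(1 / 2 :: real) ^ k * (1 - 1 / 2) ^ (n - k) = 1 / 2 ^ n"
    by (simp add: power_add[symmetric] power_divide)
  then show ?thesis by (simp add: half_binom_def Bernstein_def mult.assoc)
qed (simp add: half_binom_def Bernstein_def binomial_eq_0)

lemma pmf_binomial_half: "pmf (binomial_pmf n (1 / 2)) k = half_binom n (int k)"
  by (simp add: half_binom_of_nat Bernstein_def)

lemma sum_half_binom_mult_le:
  assumes "finite T" "\<And>t. g t \<ge> 0"
  shows "(\<Sum>t\<in>T. half_binom n t * g t) \<le> (\<Sum>k\<le>n. half_binom n (int k) * g (int k))"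
proof -
  have supp: "t \<in> int ` {..n}" if "half_binom n t \<noteq> 0" for t
  proof -
    have "t \<ge> 0" "n choose nat t \<noteq> 0" using that by (auto simp: half_binom_def split: if_splits)
    then have "t = int (nat t)" "nat t \<le> n"
      using binomial_eq_0[of n "nat t"]
      by (auto simp: not_less[symmetric] simp del: binomial_eq_0_iff)
    then show ?thesis by (metis atMost_iff image_eqI)
  qed
  have "(\<Sum>t\<in>T. half_binom n t * g t) = (\<Sum>t\<in>T \<inter> int ` {..n}. half_binom n t * g t)"
    using assms(1) supp by (intro sum.mono_neutral_right) auto
  also have "\<dots> \<le> (\<Sum>t\<in>int ` {..n}. half_binom n t * g t)"
    using assms half_binom_nonneg by (intro sum_mono2) auto
  also have "\<dots> = (\<Sum>k\<le>n. half_binom n (int k) * g (int k))"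
    by (simp add: sum.reindex)
  finally show ?thesis .
qed

lemma sum_half_binom_le_1:
  assumes "finite T"
  shows "sum (half_binom n) T \<le> 1"
  using sum_half_binom_mult_le[OF assms, of "\<lambda>_. 1" n] by (simp add: half_binom_of_nat)

lemma half_binom_second_moment:
  "(\<Sum>k\<le>n. half_binom n (int k) * (real n - 2 * real k)\<^sup>2) = real n"
proof -
  let ?B = "\<lambda>k. Bernstein n k (1 / 2)"
  have "(\<Sum>k\<le>n. half_binom n (int k) * (real n - 2 * real k)\<^sup>2)
      = (\<Sum>k\<le>n. (real n)\<^sup>2 * ?B k - (4 * real n - 4) * (real k * ?B k) + 4 * (real k * (real k - 1) * ?B k))"
    by (intro sum.cong) (auto simp: half_binom_of_nat power2_eq_square algebra_simps)
  also have "\<dots> = (real n)\<^sup>2 * (\<Sum>k\<le>n. ?B k) - (4 * real n - 4) * (\<Sum>k\<le>n. real k * ?B k)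
      + 4 * (\<Sum>k\<le>n. real k * (real k - 1) * ?B k)"
    by (simp only: sum.distrib sum_subtractf sum_distrib_left)
  also have "\<dots> = real n"
    unfolding sum_Bernstein sum_k_Bernstein sum_kk_Bernstein by (simp add: power2_eq_square field_simps)
  finally show ?thesis .
qed

text \<open>Pascal's rule gives the sum of two neighbouring coefficients and absorption gives one of
  them, both in terms of the coefficient in row \<open>Suc n\<close>; their difference
  follows.\<close>

lemma half_binom_diff:
  "half_binom n t - half_binom n (t - 1)
    = 2 * half_binom (Suc n) t * (real (Suc n) - 2 * of_int t) / real (Suc n)"
proof (cases "t \<le> 0")
  case True
  then show ?thesis by (cases "t = 0") (auto simp: half_binom_def)
next
  case False
  define k where "k = nat t - 1"
  have t: "t = int (Suc k)" "nat t = Suc k" "nat (t - 1) = k" using False by (auto simp: k_def)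
  have "Suc k * (Suc n choose Suc k) = Suc n * (n choose k)"
    by (rule Suc_times_binomial_eq[symmetric, unfolded mult.commute[of "_ choose _"]])
  then have 1: "real (Suc k) * real (Suc n choose Suc k) = real (Suc n) * real (n choose k)"
    by (metis of_nat_mult)
  have 2: "real (Suc n choose Suc k) = real (n choose k) + real (n choose Suc k)" by simp
  have main: "real (Suc n) * (real (n choose Suc k) - real (n choose k))
      = real (Suc n choose Suc k) * (real (Suc n) - 2 * real (Suc k))"
    using 1 2 by (simp add: algebra_simps del: binomial_Suc_Suc of_nat_Suc)
  have frac: "x / p - y / p = 2 * (z / (2 * p)) * w / m"
    if "m * (x - y) = z * w" "m > 0" "p > 0" for x y z w p m :: real
  proof -
    have "x / p - y / p = m * (x - y) / (m * p)" using that(2,3) by (simp add: field_simps)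
    then show ?thesis unfolding that(1) by (simp add: mult_ac)
  qed
  have "half_binom n t = real (n choose Suc k) / 2 ^ n"
    "half_binom n (t - 1) = real (n choose k) / 2 ^ n"
    "half_binom (Suc n) t = real (Suc n choose Suc k) / (2 * 2 ^ n)" "of_int t = real (Suc k)"
    using False t(2,3) by (simp_all add: half_binom_def t(1) del: binomial_Suc_Suc)
  then show ?thesis using frac[OF main, of "2 ^ n"]
    by (simp only: of_nat_0_less_iff zero_less_Suc zero_less_power zero_less_numeral)
qed

text \<open>The discrete derivative is the next binomial law times a centred linear factor, so its
  \<open>\<ell>\<^sub>1\<close> norm is governed by the standard deviation.\<close>
lemma half_binom_variation:
  assumes "finite T"
  shows "(\<Sum>t\<in>T. \<bar>half_binom n t - half_binom n (t - 1)\<bar>) \<le> 2 / sqrt (real (Suc n))"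
proof -
  define M where "M = real (Suc n)"
  define s where "s = sqrt M"
  have Mpos: "M > 0" by (simp add: M_def)
  have s: "s > 0" "M = s * s" by (simp_all add: s_def M_def)
  \<comment> \<open>By the inequality of arithmetic and geometric means, \<open>2 * d / M\<close> is
    at most \<open>1 / s + d^2 / (M * s)\<close>. This replaces an absolute first moment by the
    second moment, and each summand averages to \<open>1 / s\<close>.\<close>
  let ?g = "\<lambda>t. 1 / s + (M - 2 * of_int t)\<^sup>2 / (M * s)"
  have "(\<Sum>t\<in>T. \<bar>half_binom n t - half_binom n (t - 1)\<bar>) \<le> (\<Sum>t\<in>T. half_binom (Suc n) t * ?g t)"
  proof (rule sum_mono)
    fix t
    define d where "d = \<bar>M - 2 * of_int t\<bar>"
    have "0 \<le> (s - d)\<^sup>2" by simp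
    then have "2 * d * s \<le> s * s + d\<^sup>2" by (simp add: power2_eq_square algebra_simps)
    then have "2 * d / M \<le> 1 / s + d\<^sup>2 / (M * s)"
      using s(1) unfolding s(2) by (simp add: field_simps power2_eq_square)
    then have "half_binom (Suc n) t * (2 * d / M) \<le> half_binom (Suc n) t * (1 / s + d\<^sup>2 / (M * s))"
      by (intro mult_left_mono half_binom_nonneg)
    then show "\<bar>half_binom n t - half_binom n (t - 1)\<bar> \<le> half_binom (Suc n) t * ?g t"
      unfolding half_binom_diff using half_binom_nonneg[of "Suc n" t] Mpos
      by (simp add: abs_mult d_def M_def[symmetric] s_def mult_ac del: of_nat_Suc)
  qed
  also have "\<dots> \<le> (\<Sum>k\<le>Suc n. half_binom (Suc n) (int k) * ?g (int k))"
    using s assms by (intro sum_half_binom_mult_le) (auto simp: M_def)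
  also have "\<dots> = (\<Sum>k\<le>Suc n. half_binom (Suc n) (int k)) / s
      + (\<Sum>k\<le>Suc n. half_binom (Suc n) (int k) * (M - 2 * real k)\<^sup>2) / (M * s)"
    unfolding sum_divide_distrib sum.distrib[symmetric]
    by (intro sum.cong) (auto simp: distrib_left)
  also have "\<dots> = 1 / s + M / (M * s)"
    unfolding M_def half_binom_second_moment by (simp only: half_binom_of_nat sum_Bernstein)
  also have "\<dots> = 2 / s" using s by (simp add: M_def field_simps)
  finally show ?thesis by (simp add: s_def M_def)
qed

lemma abs_diff_shift_le_variation:
  fixes F :: "int \<Rightarrow> real"
  shows "\<bar>F t - F (t - int s)\<bar> \<le> (\<Sum>u<s. \<bar>F (t - int u) - F (t - int u - 1)\<bar>)"
proof (induction s)
  case (Suc s)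
  have "t - int (Suc s) = t - int s - 1" by simp
  then show ?case unfolding sum.lessThan_Suc using Suc by (simp only:)
qed simp

lemma eq_of_dvd_diff:
  fixes a b c :: nat
  assumes "b < a" "c < a" "int a dvd int b - int c"
  shows "b = c"
proof -
  have "int b mod int a = int c mod int a" using assms(3) by (simp add: mod_eq_dvd_iff)
  then show ?thesis using assms(1,2) by simp
qed

text \<open>Elements of one residue class modulo \<open>a\<close>, shifted by \<open>0..a-1\<close>,
  are pairwise distinct, so the double sum is a sum over a finite set.\<close>

lemma sum_residue_window_le:
  fixes \<Phi> :: "int \<Rightarrow> real"
  assumes "finite J" "\<And>i j. i \<in> J \<Longrightarrow> j \<in> J \<Longrightarrow> int a dvd i - j"
    and "\<And>T. finite T \<Longrightarrow> sum \<Phi> T \<le> C"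
  shows "(\<Sum>j\<in>J. \<Sum>d<a. \<Phi> (j - int d)) \<le> C"
proof -
  have inj: "inj_on (\<lambda>(j, d). j - int d) (J \<times> {..<a})"
  proof (rule inj_onI, clarsimp)
    fix i j d e assume *: "i \<in> J" "j \<in> J" "d < a" "e < a" "i - int d = j - int e"
    then have "i - j = int d - int e" by simp
    then have "int a dvd int d - int e" using assms(2)[OF *(1,2)] by (simp only:)
    then have "d = e" using * eq_of_dvd_diff by blast
    then show "i = j \<and> d = e" using * by simp
  qed
  have "(\<Sum>j\<in>J. \<Sum>d<a. \<Phi> (j - int d)) = (\<Sum>x\<in>J \<times> {..<a}. \<Phi> (case x of (j, d) \<Rightarrow> j - int d))"
    by (simp add: sum.cartesian_product case_prod_beta)
  also have "\<dots> = sum \<Phi> ((\<lambda>(j, d). j - int d) ` (J \<times> {..<a}))"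
    by (subst sum.reindex[OF inj]) simp
  also have "\<dots> \<le> C" using assms(1) by (intro assms(3)) auto
  finally show ?thesis .
qed

text \<open>Averaging over one period of shifts: the mass of a residue class differs from its shifts by
  at most the total variation, and the shifts partition the whole mass.\<close>
lemma sum_residue_class_le:
  fixes F :: "int \<Rightarrow> real"
  assumes "a > 0" "finite J" "\<And>i j. i \<in> J \<Longrightarrow> j \<in> J \<Longrightarrow> int a dvd i - j"
    and F: "\<And>T. finite T \<Longrightarrow> sum F T \<le> 1"
    and V: "\<And>T. finite T \<Longrightarrow> (\<Sum>t\<in>T. \<bar>F t - F (t - 1)\<bar>) \<le> V"
  shows "sum F J \<le> 1 / real a + V"
proof -
  let ?G = "\<lambda>t. \<bar>F t - F (t - 1)\<bar>"
  have "real a * sum F J = (\<Sum>j\<in>J. \<Sum>d<a. F j)" by (simp add: sum_distrib_left)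
  also have "\<dots> \<le> (\<Sum>j\<in>J. \<Sum>d<a. F (j - int d) + (\<Sum>u<a. ?G (j - int u)))"
  proof (intro sum_mono)
    fix j d assume "d \<in> {..<a}"
    then have "(\<Sum>u<d. ?G (j - int u)) \<le> (\<Sum>u<a. ?G (j - int u))" by (intro sum_mono2) auto
    then show "F j \<le> F (j - int d) + (\<Sum>u<a. ?G (j - int u))"
      using abs_diff_shift_le_variation[of F j d] by linarith
  qed
  also have "\<dots> = (\<Sum>j\<in>J. \<Sum>d<a. F (j - int d)) + real a * (\<Sum>j\<in>J. \<Sum>u<a. ?G (j - int u))"
    by (simp add: sum.distrib sum_distrib_left)
  also have "\<dots> \<le> 1 + real a * V"
    using sum_residue_window_le[OF assms(2,3), of F 1] sum_residue_window_le[OF assms(2,3), of ?G V] F V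
    by (intro add_mono mult_left_mono) auto
  finally show ?thesis using assms(1) by (simp add: field_simps)
qed

lemma half_binom_residue_class_le:
  assumes "a > 0" "finite K" "\<And>i j. i \<in> K \<Longrightarrow> j \<in> K \<Longrightarrow> int a dvd int i - int j"
  shows "(\<Sum>k\<in>K. half_binom (a\<^sup>2 div 16) (int k)) \<le> 9 / real a"
proof -
  define n where "n = a\<^sup>2 div 16"
  have "(\<Sum>k\<in>K. half_binom n (int k)) = sum (half_binom n) (int ` K)" by (simp add: sum.reindex)
  also have "\<dots> \<le> 1 / real a + 2 / sqrt (real (Suc n))"
    using assms sum_half_binom_le_1 half_binom_variation by (intro sum_residue_class_le) auto
  also have "2 / sqrt (real (Suc n)) \<le> 8 / real a"
  proof -
    \<comment> \<open>The successor absorbs the rounding in \<open>a^2 div 16\<close>, so small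
      \<open>a\<close> with \<open>n = 0\<close> is covered too.\<close>
    have "a\<^sup>2 \<le> 16 * Suc n" unfolding n_def by simp
    then have "(real a)\<^sup>2 \<le> 16 * real (Suc n)" by (metis of_nat_le_iff of_nat_mult of_nat_numeral of_nat_power)
    then have "real a \<le> sqrt (16 * real (Suc n))" by (rule real_le_rsqrt)
    also have "\<dots> = 4 * sqrt (real (Suc n))" unfolding real_sqrt_mult by simp
    finally show ?thesis using assms(1) by (simp add: field_simps)
  qed
  finally show ?thesis unfolding n_def using assms(1) by (simp add: field_simps)
qed

subsection \<open>The hard targets and a common dominating law\<close>

text \<open>Zero parameters switch off the remaining coins, so a PBD over \<open>N\<close> coins can
  have a variance independent of \<open>N\<close>.\<close>

lemma pbd_half_eq_binomial:
  assumes "n \<le> N"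
  shows "pbd N (\<lambda>i. if i < n then 1 / 2 else 0) = binomial_pmf n (1 / 2)"
proof -
  have b0: "bernoulli_pmf 0 = return_pmf False"
    by (rule pmf_eqI) (auto simp: indicator_def pmf_return split: bool.splits)
  have "Pi_pmf {..<N} False (\<lambda>i. bernoulli_pmf (if i < n then 1 / 2 else 0))
      = Pi_pmf {..<n} False (\<lambda>i. bernoulli_pmf (if i < n then 1 / 2 else 0))"
    using assms b0 by (intro Pi_pmf_subset') auto
  also have "\<dots> = Pi_pmf {..<n} False (\<lambda>i. bernoulli_pmf (1 / 2))"
    by (intro Pi_pmf_cong) auto
  finally have "pbd N (\<lambda>i. if i < n then 1 / 2 else 0)
      = map_pmf (\<lambda>f. card {i\<in>{..<N}. f i}) (Pi_pmf {..<n} False (\<lambda>i. bernoulli_pmf (1 / 2)))"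
    by (simp add: pbd_def)
  also have "\<dots> = map_pmf (\<lambda>f. card {i\<in>{..<n}. f i}) (Pi_pmf {..<n} False (\<lambda>i. bernoulli_pmf (1 / 2)))"
  proof (rule map_pmf_cong[OF refl])
    fix f assume "f \<in> set_pmf (Pi_pmf {..<n} False (\<lambda>i. bernoulli_pmf (1 / 2)))"
    then have "\<And>i. i \<notin> {..<n} \<Longrightarrow> f i = False"
      using set_Pi_pmf_subset[of "{..<n}" False "\<lambda>i. bernoulli_pmf (1 / 2)"] by blast
    then have "{i\<in>{..<N}. f i} = {i\<in>{..<n}. f i}" using assms by auto
    then show "card {i\<in>{..<N}. f i} = card {i\<in>{..<n}. f i}" by simp
  qed
  also have "\<dots> = binomial_pmf n (1 / 2)"
    by (rule binomial_pmf_altdef'[symmetric]) auto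
  finally show ?thesis .
qed

text \<open>Both parameter functions have the shape that \<open>pbd_half_eq_binomial\<close>
  rewrites, with \<open>n\<close> and with \<open>N\<close>.\<close>

definition hard_target :: "nat \<Rightarrow> nat \<Rightarrow> nat \<Rightarrow> nat \<Rightarrow> int pmf" where
  "hard_target N n a b = weighted_pbd_sum N b a (\<lambda>i. if i < n then 1 / 2 else 0) (\<lambda>i. if i < N then 1 / 2 else 0)"

lemma hard_target_eq:
  assumes "n \<le> N"
  shows "hard_target N n a b = map_pmf (\<lambda>(x, y). int b * int x + int a * int y)
    (pair_pmf (binomial_pmf n (1 / 2)) (binomial_pmf N (1 / 2)))"
  unfolding hard_target_def weighted_pbd_sum_def
  by (simp add: pbd_half_eq_binomial assms pair_pmf_def map_bind_pmf)

lemma finite_set_pmf_hard_target: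
  assumes "n \<le> N"
  shows "finite (set_pmf (hard_target N n a b))"
  by (simp add: hard_target_eq[OF assms])

text \<open>An upper bound for the maximum of \<open>half_binom N\<close> on the window from
  \<open>t - n\<close> to \<open>t\<close>: its value at \<open>t\<close> plus the variation across
  the window. Unlike the maximum, it is easily summed over \<open>t\<close>.\<close>

definition window_sup :: "nat \<Rightarrow> nat \<Rightarrow> int \<Rightarrow> real" where
  "window_sup N n t = half_binom N t
     + (\<Sum>u<n. \<bar>half_binom N (t - int u) - half_binom N (t - int u - 1)\<bar>)"

lemma window_sup_nonneg: "window_sup N n t \<ge> 0"
  unfolding window_sup_def by (intro add_nonneg_nonneg sum_nonneg half_binom_nonneg) simp

lemma half_binom_le_window_sup:
  assumes "s \<le> n"
  shows "half_binom N (t - int s) \<le> window_sup N n t"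
proof -
  let ?G = "\<lambda>u. \<bar>half_binom N (t - int u) - half_binom N (t - int u - 1)\<bar>"
  have "(\<Sum>u<s. ?G u) \<le> (\<Sum>u<n. ?G u)" using assms by (intro sum_mono2) auto
  then show ?thesis
    using abs_diff_shift_le_variation[of "half_binom N" t s] unfolding window_sup_def by linarith
qed

text \<open>Each of the \<open>n\<close> shifts costs a variation of
  \<open>2 / sqrt (N + 1)\<close>; the condition on \<open>N\<close> makes the total cost at most
  1.\<close>

lemma sum_window_sup_le:
  assumes "finite T" "4 * n\<^sup>2 \<le> Suc N"
  shows "sum (window_sup N n) T \<le> 2"
proof -
  let ?G = "\<lambda>t. \<bar>half_binom N t - half_binom N (t - 1)\<bar>"
  have "sum (window_sup N n) T = sum (half_binom N) T + (\<Sum>u<n. \<Sum>t\<in>T. ?G (t - int u))"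
    unfolding window_sup_def by (simp add: sum.distrib sum.swap[of _ _ T])
  also have "\<dots> \<le> 1 + (\<Sum>u<n. 2 / sqrt (real (Suc N)))"
  proof (intro add_mono sum_mono sum_half_binom_le_1 assms)
    fix u
    have "(\<Sum>t\<in>T. ?G (t - int u)) = sum ?G ((\<lambda>t. t - int u) ` T)"
      by (subst sum.reindex) (auto simp: inj_on_def)
    also have "\<dots> \<le> 2 / sqrt (real (Suc N))" using assms by (intro half_binom_variation) auto
    finally show "(\<Sum>t\<in>T. ?G (t - int u)) \<le> 2 / sqrt (real (Suc N))" .
  qed
  also have "(\<Sum>u<n. 2 / sqrt (real (Suc N))) \<le> 1"
  proof -
    have "(2 * n)\<^sup>2 \<le> Suc N" using assms(2) by (simp add: power2_eq_square)
    then have "(real (2 * n))\<^sup>2 \<le> real (Suc N)" by (metis of_nat_le_iff of_nat_power)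
    then have "real (2 * n) \<le> sqrt (real (Suc N))" by (rule real_le_rsqrt)
    then show ?thesis by (simp add: field_simps)
  qed
  finally show ?thesis by simp
qed

lemma sum_div_le:
  fixes g :: "int \<Rightarrow> real"
  assumes "a > 0" "finite F" "\<And>t. g t \<ge> 0" "\<And>T. finite T \<Longrightarrow> sum g T \<le> C"
  shows "(\<Sum>z\<in>F. g (z div int a)) \<le> real a * C"
proof -
  have "(\<Sum>z\<in>F. g (z div int a)) = (\<Sum>t\<in>(\<lambda>z. z div int a) ` F. \<Sum>z\<in>{z\<in>F. z div int a = t}. g (z div int a))"
    using assms(2) by (rule sum.image_gen)
  also have "\<dots> \<le> (\<Sum>t\<in>(\<lambda>z. z div int a) ` F. real a * g t)"
  proof (rule sum_mono)
    fix t
    have "{z\<in>F. z div int a = t} \<subseteq> {int a * t..<int a * t + int a}"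
      using assms(1) by (auto simp: minus_mod_eq_mult_div[symmetric])
    then have "card {z\<in>F. z div int a = t} \<le> card {int a * t..<int a * t + int a}"
      by (intro card_mono) auto
    then have "card {z\<in>F. z div int a = t} \<le> a" by simp
    then show "(\<Sum>z\<in>{z\<in>F. z div int a = t}. g (z div int a)) \<le> real a * g t"
      using assms(3)[of t] by (simp add: mult_right_mono)
  qed
  also have "\<dots> = real a * sum g ((\<lambda>z. z div int a) ` F)" by (simp add: sum_distrib_left)
  also have "\<dots> \<le> real a * C" using assms by (intro mult_left_mono) auto
  finally show ?thesis .
qed

lemma dvd_of_dvd_mult_less_prime:
  assumes "prime a" "b \<in> {1..<a}" "int a dvd int b * x"
  shows "int a dvd x"
proof -
  have "\<not> int a dvd int b" using assms(2) by (auto dest: zdvd_imp_le)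
  then show ?thesis using assms by (auto simp: prime_dvd_mult_iff)
qed

text \<open>Condition on the value \<open>j\<close> of the first binomial. The second one must equal
  \<open>(z - b * j) / a\<close>, which lies in a window of length \<open>n\<close> below
  \<open>z div a\<close>. The \<open>j\<close> for which this is an integer form one residue class,
  since \<open>b\<close> is invertible modulo \<open>a\<close>, and so have mass at most
  \<open>9 / a\<close>.\<close>

lemma pmf_hard_target_le:
  assumes a: "prime a" and b: "b \<in> {1..<a}" and n: "n = a\<^sup>2 div 16" "n \<le> N"
  shows "pmf (hard_target N n a b) z \<le> window_sup N n (z div int a) * (9 / real a)"
proof -
  have a0: "a > 0" using a by (rule prime_gt_0_nat)
  let ?h = "window_sup N n (z div int a)"
  let ?K = "{j\<in>{..n}. int a dvd z - int b * int j}"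
  let ?f = "\<lambda>j y. int b * int j + int a * int y"
  have inner: "pmf (map_pmf (?f j) (binomial_pmf N (1 / 2))) z
      \<le> (if int a dvd z - int b * int j then ?h else 0)" if j: "j \<le> n" for j
  proof (cases "z \<in> range (?f j)")
    case False
    then have "pmf (map_pmf (?f j) (binomial_pmf N (1 / 2))) z = 0"
      by (intro pmf_map_outside) auto
    then show ?thesis using window_sup_nonneg by simp
  next
    case True
    then obtain y where y: "z = ?f j y" by auto
    have "inj (?f j)" using a0 by (auto simp: inj_def)
    then have eq: "pmf (map_pmf (?f j) (binomial_pmf N (1 / 2))) z = half_binom N (int y)"
      unfolding y by (subst pmf_map_inj') (simp_all add: pmf_binomial_half del: pmf_binomial)
    have "int b * int j \<le> int a * int n" using b j by (intro mult_mono) auto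
    then have "z div int a \<le> (int a * (int y + int n)) div int a"
      unfolding y using a0 by (intro zdiv_mono1) (auto simp: algebra_simps)
    moreover have "(int a * int y) div int a \<le> z div int a"
      unfolding y using a0 by (intro zdiv_mono1) auto
    ultimately have "int y \<le> z div int a" "z div int a \<le> int y + int n" using a0 by auto
    then have "half_binom N (z div int a - int (nat (z div int a - int y))) \<le> ?h"
      by (intro half_binom_le_window_sup) auto
    then have "half_binom N (int y) \<le> ?h" using \<open>int y \<le> z div int a\<close> by simp
    moreover have "int a dvd z - int b * int j" unfolding y by simp
    ultimately show ?thesis using eq by simp
  qed
  have "hard_target N n a b = binomial_pmf n (1 / 2) \<bind> (\<lambda>j. map_pmf (?f j) (binomial_pmf N (1 / 2)))"
    unfolding hard_target_eq[OF n(2)] by (simp add: pair_pmf_def map_pmf_def bind_assoc_pmf bind_return_pmf)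
  then have "pmf (hard_target N n a b) z = measure_pmf.expectation (binomial_pmf n (1 / 2))
      (\<lambda>j. pmf (map_pmf (?f j) (binomial_pmf N (1 / 2))) z)"
    by (simp only: pmf_bind)
  also have "\<dots> = (\<Sum>j\<le>n. pmf (map_pmf (?f j) (binomial_pmf N (1 / 2))) z * half_binom n (int j))"
    unfolding pmf_binomial_half[symmetric] by (rule integral_measure_pmf_real) auto
  also have "\<dots> \<le> (\<Sum>j\<le>n. (if int a dvd z - int b * int j then ?h else 0) * half_binom n (int j))"
    by (intro sum_mono mult_right_mono inner half_binom_nonneg) auto
  also have "\<dots> = (\<Sum>j\<in>?K. ?h * half_binom n (int j))"
    by (subst sum.inter_filter) (auto intro!: sum.cong)
  also have "\<dots> = ?h * (\<Sum>j\<in>?K. half_binom n (int j))" by (simp add: sum_distrib_left)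
  also have "\<dots> \<le> ?h * (9 / real a)"
  proof (intro mult_left_mono window_sup_nonneg)
    show "(\<Sum>j\<in>?K. half_binom n (int j)) \<le> 9 / real a"
      unfolding n(1)
    proof (rule half_binom_residue_class_le)
      fix i j assume "i \<in> {j\<in>{..a\<^sup>2 div 16}. int a dvd z - int b * int j}"
        "j \<in> {j\<in>{..a\<^sup>2 div 16}. int a dvd z - int b * int j}"
      then have "int a dvd (z - int b * int j) - (z - int b * int i)" by (intro dvd_diff[of _ "z - int b * int j"]) auto
      then have "int a dvd int b * (int i - int j)" by (simp add: algebra_simps)
      then show "int a dvd int i - int j" using dvd_of_dvd_mult_less_prime a b by blast
    qed (use a0 in auto)
  qed
  finally show ?thesis .
qed

lemma ex_pmf_dominating_hard_targets:
  assumes a: "prime a" and n: "n = a\<^sup>2 div 16" "n \<le> N" "4 * n\<^sup>2 \<le> Suc N"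
  shows "\<exists>Q. \<forall>b\<in>{1..<a}. \<forall>z. pmf (hard_target N n a b) z \<le> 18 * pmf Q z"
proof (rule ex_dominating_pmf)
  show "{1..<a} \<noteq> {}" using prime_ge_2_nat[OF a] by auto
  show "pmf (hard_target N n a b) z \<le> window_sup N n (z div int a) * (9 / real a)"
    if "b \<in> {1..<a}" for b z using pmf_hard_target_le a that n by blast
  fix F :: "int set" assume F: "finite F"
  have a0: "a > 0" using a by (rule prime_gt_0_nat)
  have "(\<Sum>z\<in>F. window_sup N n (z div int a)) \<le> real a * 2"
    using a0 F window_sup_nonneg sum_window_sup_le n(3) by (intro sum_div_le) auto
  \<comment> \<open>Division by \<open>a\<close> is \<open>a\<close>-to-one, so the envelope has
    mass at most \<open>a * 2 * (9 / a) = 18\<close>.\<close>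
  then have "(\<Sum>z\<in>F. window_sup N n (z div int a)) * (9 / real a) \<le> real a * 2 * (9 / real a)"
    by (rule mult_right_mono) simp
  then show "(\<Sum>z\<in>F. window_sup N n (z div int a) * (9 / real a)) \<le> 18"
    using a0 by (simp only: sum_distrib_right) simp
qed (use n finite_set_pmf_hard_target in auto)

subsection \<open>Fourier coefficients of the hard targets\<close>

text \<open>The characteristic function of the symmetric binomial law at the frequency
  \<open>2 * pi * c / a\<close>.\<close>

definition half_binom_fourier :: "nat \<Rightarrow> nat \<Rightarrow> int \<Rightarrow> complex" where
  "half_binom_fourier n a c =
     (\<Sum>j\<le>n. of_real (half_binom n (int j)) * cis (2 * pi * of_int (c * int j) / real a))"

lemma cis_two_pi_periodic:
  assumes "a > 0" "int a dvd x - y"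
  shows "cis (2 * pi * of_int x / real a) = cis (2 * pi * of_int y / real a)"
proof -
  obtain l where l: "x - y = int a * l" using assms(2) by (elim dvdE)
  then have "x = y + int a * l" by simp
  then have "2 * pi * of_int x / real a = 2 * pi * of_int y / real a + 2 * pi * of_int l"
    using assms(1) by (simp add: field_simps)
  then show ?thesis by (simp add: cis_mult[symmetric] cis_multiple_2pi)
qed

lemma half_binom_fourier_periodic:
  assumes "a > 0" "int a dvd c - d"
  shows "half_binom_fourier n a c = half_binom_fourier n a d"
  unfolding half_binom_fourier_def
proof (intro sum.cong refl arg_cong2[where f = "(*)"] cis_two_pi_periodic assms(1))
  fix j
  have "c * int j - d * int j = (c - d) * int j" by (simp add: algebra_simps)
  then show "int a dvd c * int j - d * int j" using assms(2) by simp
qed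

lemma cos_ge_one_minus: "1 - x\<^sup>2 / 2 \<le> cos (x :: real)"
proof -
  have "(sin (x / 2))\<^sup>2 \<le> (x / 2)\<^sup>2" using abs_sin_x_le_abs_x[of "x / 2"] by (simp only: abs_le_square_iff)
  then show ?thesis using cos_double_sin[of "x / 2"] by (simp add: power_divide)
qed

text \<open>By the binomial theorem the modulus is the \<open>n\<close>-th power of
  \<open>cos (pi / a)\<close>. The cosine is at least \<open>1 - 8 / a^2\<close>, and Bernoulli's
  inequality with \<open>n \<le> a^2 / 16\<close> loses at most one half.\<close>

lemma norm_half_binom_fourier_1_ge:
  assumes "a > 0" "n = a\<^sup>2 div 16"
  shows "1 / 2 \<le> norm (half_binom_fourier n a 1)"
proof -
  define \<theta> where "\<theta> = pi / real a"
  have "half_binom_fourier n a 1 = (\<Sum>j\<le>n. of_nat (n choose j) * cis (2 * \<theta>) ^ j * 1 ^ (n - j)) / 2 ^ n"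
    unfolding half_binom_fourier_def sum_divide_distrib
  proof (intro sum.cong refl)
    fix j
    have "cis (2 * \<theta>) ^ j = cis (2 * pi * of_int (1 * int j) / real a)"
      unfolding Complex.DeMoivre \<theta>_def by (intro arg_cong[where f = cis]) simp
    then show "of_real (half_binom n (int j)) * cis (2 * pi * of_int (1 * int j) / real a)
        = of_nat (n choose j) * cis (2 * \<theta>) ^ j * 1 ^ (n - j) / 2 ^ n"
      by (simp add: half_binom_def)
  qed
  also have "\<dots> = ((cis (2 * \<theta>) + 1) / 2) ^ n" by (simp add: binomial_ring power_divide)
  also have "(cis (2 * \<theta>) + 1) / 2 = of_real (cos \<theta>) * cis \<theta>"
    by (simp add: complex_eq_iff cos_double_cos sin_double power2_eq_square)
  finally have eq: "norm (half_binom_fourier n a 1) = \<bar>cos \<theta>\<bar> ^ n"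
    by (simp add: norm_power norm_mult)
  show ?thesis
  proof (cases "n = 0")
    case True
    then show ?thesis using eq by simp
  next
    case False
    \<comment> \<open>Nonzero \<open>n\<close> forces \<open>a \<ge> 4\<close>, which keeps the base
      \<open>1 - 8 / a^2\<close> nonnegative.\<close>
    then have "a\<^sup>2 \<ge> 16" using assms(2) by (metis div_less not_le)
    then have a16: "(real a)\<^sup>2 \<ge> 16" by (metis of_nat_le_iff of_nat_numeral of_nat_power)
    have "pi\<^sup>2 \<le> 4\<^sup>2" using pi_less_4 by (intro power_mono) auto
    then have "pi\<^sup>2 / 2 / (real a)\<^sup>2 \<le> 8 / (real a)\<^sup>2" by (intro divide_right_mono) auto
    then have "\<theta>\<^sup>2 / 2 \<le> 8 / (real a)\<^sup>2" by (simp add: \<theta>_def power_divide)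
    then have c: "1 + - (8 / (real a)\<^sup>2) \<le> cos \<theta>" using cos_ge_one_minus[of \<theta>] by linarith
    have le: "8 / (real a)\<^sup>2 \<le> 1" using a16 by (simp add: divide_le_eq)
    have "16 * n \<le> a\<^sup>2" using assms(2) by simp
    then have "16 * real n \<le> (real a)\<^sup>2" by (metis of_nat_le_iff of_nat_mult of_nat_numeral of_nat_power)
    then have "real n * (8 / (real a)\<^sup>2) \<le> 1 / 2" using a16 by (simp add: divide_le_eq)
    then have "1 / 2 \<le> 1 + real n * - (8 / (real a)\<^sup>2)" by simp
    also have "\<dots> \<le> (1 + - (8 / (real a)\<^sup>2)) ^ n" using le by (intro Bernoulli_inequality) simp
    also have "\<dots> \<le> \<bar>cos \<theta>\<bar> ^ n" using c le by (intro power_mono) auto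
    finally show ?thesis using eq by simp
  qed
qed

lemma sum_cis_orthogonal:
  assumes "a > 0"
  shows "(\<Sum>k<a. cis (2 * pi * of_int (int k * d) / real a)) = (if int a dvd d then of_nat a else 0)"
proof -
  define w where "w = cis (2 * pi * of_int d / real a)"
  have pw: "w ^ k = cis (2 * pi * of_int (int k * d) / real a)" for k
    unfolding w_def Complex.DeMoivre by (intro arg_cong[where f = cis]) simp
  have "(\<Sum>k<a. cis (2 * pi * of_int (int k * d) / real a)) = (\<Sum>k<a. w ^ k)" by (simp only: pw)
  also have "\<dots> = (if int a dvd d then of_nat a else 0)"
  proof (cases "int a dvd d")
    case True
    then have "w = 1" using cis_two_pi_periodic[OF assms, of d 0] by (simp add: w_def)
    then show ?thesis using True by simp
  next
    case False
    have "w \<noteq> 1"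
    proof
      assume "w = 1"
      then have "cos (2 * pi * of_int d / real a) = 1" by (simp add: w_def complex_eq_iff)
      then obtain l :: int where "2 * pi * of_int d / real a = of_int l * 2 * pi"
        by (auto simp: cos_one_2pi_int)
      then have "real_of_int d = of_int (l * int a)" using assms by (simp add: field_simps)
      then have "d = l * int a" by (simp only: of_int_eq_iff)
      then show False using False by simp
    qed
    moreover have "w ^ a = 1"
      unfolding pw using cis_two_pi_periodic[OF assms, of "int a * d" 0] by simp
    ultimately show ?thesis using False by (simp add: geometric_sum)
  qed
  finally show ?thesis .
qed

text \<open>Expanding the squares and summing over \<open>k\<close> leaves \<open>a\<close> times
  the probability that two independent copies agree modulo \<open>a\<close>. Given the first copy,
  this is at most \<open>9 / a\<close>.\<close>

lemma half_binom_fourier_parseval_le: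
  assumes a: "prime a" and b: "b \<in> {1..<a}" and n: "n = a\<^sup>2 div 16"
  shows "(\<Sum>k<a. (norm (half_binom_fourier n a (int k * int b)))\<^sup>2) \<le> 9"
proof -
  have a0: "a > 0" using a by (rule prime_gt_0_nat)
  let ?m = "\<lambda>j. half_binom n (int j)"
  let ?d = "\<lambda>i j. int b * (int i - int j)"
  have sq: "complex_of_real ((norm (half_binom_fourier n a (int k * int b)))\<^sup>2)
      = (\<Sum>i\<le>n. \<Sum>j\<le>n. of_real (?m i * ?m j) * cis (2 * pi * of_int (int k * ?d i j) / real a))" for k
  proof -
    have "complex_of_real ((norm (half_binom_fourier n a (int k * int b)))\<^sup>2)
        = half_binom_fourier n a (int k * int b) * cnj (half_binom_fourier n a (int k * int b))"
      by (rule complex_norm_square)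
    also have "\<dots> = (\<Sum>i\<le>n. \<Sum>j\<le>n. of_real (?m i * ?m j) * cis (2 * pi * of_int (int k * ?d i j) / real a))"
      unfolding half_binom_fourier_def cnj_sum sum_product
    proof (intro sum.cong refl)
      fix i j
      have "cis (2 * pi * of_int (int k * int b * int i) / real a)
          * cis (- (2 * pi * of_int (int k * int b * int j) / real a))
          = cis (2 * pi * of_int (int k * ?d i j) / real a)"
        unfolding cis_mult by (simp add: diff_divide_distrib[symmetric] algebra_simps)
      then show "of_real (?m i) * cis (2 * pi * of_int (int k * int b * int i) / real a)
          * cnj (of_real (?m j) * cis (2 * pi * of_int (int k * int b * int j) / real a))
          = of_real (?m i * ?m j) * cis (2 * pi * of_int (int k * ?d i j) / real a)"
        by (simp add: cis_cnj mult_ac)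
    qed
    finally show ?thesis .
  qed
  have "complex_of_real (\<Sum>k<a. (norm (half_binom_fourier n a (int k * int b)))\<^sup>2)
      = (\<Sum>k<a. \<Sum>i\<le>n. \<Sum>j\<le>n. of_real (?m i * ?m j) * cis (2 * pi * of_int (int k * ?d i j) / real a))"
    by (simp only: of_real_sum sq)
  also have "\<dots> = (\<Sum>i\<le>n. \<Sum>j\<le>n. of_real (?m i * ?m j) * (\<Sum>k<a. cis (2 * pi * of_int (int k * ?d i j) / real a)))"
    unfolding sum_distrib_left by (subst sum.swap) (intro sum.cong refl sum.swap)
  also have "\<dots> = (\<Sum>i\<le>n. \<Sum>j\<le>n. of_real (?m i * ?m j * (if int a dvd ?d i j then real a else 0)))"
    unfolding sum_cis_orthogonal[OF a0] by (intro sum.cong refl) simp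
  also have "\<dots> = of_real (\<Sum>i\<le>n. \<Sum>j\<le>n. ?m i * ?m j * (if int a dvd ?d i j then real a else 0))"
    by (simp only: of_real_sum)
  finally have "(\<Sum>k<a. (norm (half_binom_fourier n a (int k * int b)))\<^sup>2)
      = (\<Sum>i\<le>n. \<Sum>j\<le>n. ?m i * ?m j * (if int a dvd ?d i j then real a else 0))"
    by (simp only: of_real_eq_iff)
  also have "\<dots> = (\<Sum>i\<le>n. ?m i * (real a * (\<Sum>j\<in>{j\<in>{..n}. int a dvd ?d i j}. ?m j)))"
    unfolding sum_distrib_left by (subst sum.inter_filter) (auto intro!: sum.cong)
  also have "\<dots> \<le> (\<Sum>i\<le>n. ?m i * 9)"
  proof (intro sum_mono mult_left_mono half_binom_nonneg)
    fix i
    have "(\<Sum>j\<in>{j\<in>{..n}. int a dvd ?d i j}. ?m j) \<le> 9 / real a"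
      unfolding n
    proof (rule half_binom_residue_class_le)
      fix j k assume "j \<in> {j\<in>{..a\<^sup>2 div 16}. int a dvd ?d i j}" "k \<in> {j\<in>{..a\<^sup>2 div 16}. int a dvd ?d i j}"
      then have "int a dvd int i - int j" "int a dvd int i - int k"
        using dvd_of_dvd_mult_less_prime[OF a b] by blast+
      then have "int a dvd (int i - int k) - (int i - int j)" by (rule dvd_diff[rotated])
      then show "int a dvd int j - int k" by simp
    qed (use a0 in auto)
    then show "real a * (\<Sum>j\<in>{j\<in>{..n}. int a dvd ?d i j}. ?m j) \<le> 9"
      using a0 by (simp add: field_simps)
  qed
  also have "\<dots> = 9" by (simp add: half_binom_of_nat sum_distrib_right[symmetric])
  finally show ?thesis .
qed

text \<open>The summand that is a multiple of \<open>a\<close> rotates by full turns and drops out.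
  Allowing any finite \<open>F\<close> above the support lets two targets be compared over a common
  set.\<close>

lemma hard_target_fourier:
  assumes "a > 0" "n \<le> N" "finite F" "set_pmf (hard_target N n a b) \<subseteq> F"
  shows "(\<Sum>z\<in>F. of_real (pmf (hard_target N n a b) z) * cis (2 * pi * of_int (k * z) / real a))
    = half_binom_fourier n a (k * int b)"
proof -
  let ?e = "\<lambda>z. cis (2 * pi * of_int (k * z) / real a)"
  let ?X = "binomial_pmf n (1 / 2)" and ?Y = "binomial_pmf N (1 / 2)"
  have "(\<Sum>z\<in>F. of_real (pmf (hard_target N n a b) z) * ?e z)
      = measure_pmf.expectation (hard_target N n a b) ?e"
    using assms(3,4) by (subst integral_measure_pmf[of F]) (auto simp: scaleR_conv_of_real)
  also have "\<dots> = measure_pmf.expectation (pair_pmf ?X ?Y) (\<lambda>(x, y). ?e (int b * int x + int a * int y))"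
    by (simp add: hard_target_eq[OF assms(2)] case_prod_unfold)
  also have "(\<lambda>(x, y). ?e (int b * int x + int a * int y)) = (\<lambda>p. ?e (int b * int (fst p)))"
  proof (rule ext, clarify)
    fix x y :: nat
    show "?e (int b * int x + int a * int y) = ?e (int b * int (fst (x, y)))"
      by (rule cis_two_pi_periodic[OF assms(1)]) (simp add: algebra_simps)
  qed
  also have "measure_pmf.expectation (pair_pmf ?X ?Y) \<dots>
      = measure_pmf.expectation (map_pmf fst (pair_pmf ?X ?Y)) (\<lambda>x. ?e (int b * int x))"
    by simp
  also have "\<dots> = measure_pmf.expectation ?X (\<lambda>x. ?e (int b * int x))"
    by (simp only: map_fst_pair_pmf)
  also have "\<dots> = (\<Sum>j\<le>n. pmf ?X j *\<^sub>R ?e (int b * int j))"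
    by (rule integral_measure_pmf) auto
  also have "\<dots> = half_binom_fourier n a (k * int b)"
    unfolding half_binom_fourier_def pmf_binomial_half
    by (intro sum.cong) (auto simp: scaleR_conv_of_real mult_ac)
  finally show ?thesis .
qed

lemma prime_inverse_mod:
  assumes "prime a" "b \<in> {1..<a}"
  shows "\<exists>k<a. int a dvd int k * int b - 1"
proof -
  have "coprime (int b) (int a)"
    using assms by (metis atLeastLessThan_iff coprime_commute coprime_int_iff dvd_imp_le le_zero_eq
        not_le not_one_le_zero prime_imp_coprime zero_less_iff_neq_zero)
  then obtain u v where uv: "u * int b + v * int a = 1"
    using bezout_int[of "int b" "int a"] by (auto simp: coprime_iff_gcd_eq_1)
  have a0: "a > 0" using assms(1) by (rule prime_gt_0_nat)
  have "u mod int a * int b - 1 = - int a * (u div int a * int b + v)"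
    using uv by (simp add: minus_div_mult_eq_mod[symmetric] algebra_simps)
  then have "int a dvd u mod int a * int b - 1" by simp
  then show ?thesis using a0
    by (intro exI[of _ "nat (u mod int a)"]) (auto simp: nat_less_iff)
qed

text \<open>The distribution with multiplier \<open>b\<close> has a large Fourier coefficient at \<open>b\<^sup>-\<^sup>1\<close> modulo \<open>a\<close>; by
  Parseval a single distribution has only boundedly many large coefficients.\<close>
lemma card_close_hard_targets_le:
  assumes a: "prime a" and n: "n = a\<^sup>2 div 16" "n \<le> N" and b0: "b0 \<in> {1..<a}"
  shows "card {b\<in>{1..<a}. dtv (hard_target N n a b) (hard_target N n a b0) \<le> 2 * (1 / 16)} \<le> 144"
    (is "card ?B \<le> _")
proof -
  have a0: "a > 0" using a by (rule prime_gt_0_nat)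
  obtain k where k: "\<And>b. b \<in> {1..<a} \<Longrightarrow> k b < a \<and> int a dvd int (k b) * int b - 1"
    using prime_inverse_mod[OF a] by metis
  have inj: "inj_on k ?B"
  proof (rule inj_onI)
    fix b c assume bc: "b \<in> ?B" "c \<in> ?B" "k b = k c"
    \<comment> \<open>Distinct multipliers have distinct inverses: the combination cancels the
      common product.\<close>
    have "int a dvd int b * (int (k b) * int c - 1) - int c * (int (k b) * int b - 1)"
      using k[of b] k[of c] bc by (intro dvd_diff[of _ "int b * _"] dvd_mult) auto
    also have "int b * (int (k b) * int c - 1) - int c * (int (k b) * int b - 1) = int c - int b"
      by (simp add: algebra_simps)
    finally have "int a dvd int c - int b" .
    then show "b = c" using bc eq_of_dvd_diff[of c a b] by simp
  qed
  have large: "1 / 16 \<le> (norm (half_binom_fourier n a (int (k b) * int b0)))\<^sup>2" if b: "b \<in> ?B" for b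
  proof -
    let ?F = "set_pmf (hard_target N n a b) \<union> set_pmf (hard_target N n a b0)"
    have fin: "finite ?F" using finite_set_pmf_hard_target[OF n(2)] by simp
    have "half_binom_fourier n a (int (k b) * int b) = half_binom_fourier n a 1"
      using k[of b] b by (intro half_binom_fourier_periodic a0) auto
    then have "1 / 2 \<le> norm (half_binom_fourier n a (int (k b) * int b))"
      using norm_half_binom_fourier_1_ge[OF a0 n(1)] by simp
    moreover have "norm (half_binom_fourier n a (int (k b) * int b) - half_binom_fourier n a (int (k b) * int b0))
        \<le> 2 * dtv (hard_target N n a b) (hard_target N n a b0)"
      using norm_sum_pmf_diff_le_dtv[OF fin, of "\<lambda>z. cis (2 * pi * of_int (int (k b) * z) / real a)"
          "hard_target N n a b" "hard_target N n a b0"]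
      by (simp only: hard_target_fourier[OF a0 n(2) fin] Un_upper1 Un_upper2 norm_cis order_refl)
    moreover have "dtv (hard_target N n a b) (hard_target N n a b0) \<le> 1 / 8" using b by simp
    \<comment> \<open>The coefficient loses at most \<open>2 * (1 / 8)\<close> from
      \<open>1 / 2\<close>.\<close>
    ultimately have "1 / 4 \<le> norm (half_binom_fourier n a (int (k b) * int b0))"
      using norm_triangle_ineq2[of "half_binom_fourier n a (int (k b) * int b)"
          "half_binom_fourier n a (int (k b) * int b0)"] by linarith
    then have "(1 / 4)\<^sup>2 \<le> (norm (half_binom_fourier n a (int (k b) * int b0)))\<^sup>2"
      by (intro power_mono) auto
    then show ?thesis by (simp add: power2_eq_square)
  qed
  \<comment> \<open>Each close target contributes \<open>1 / 16\<close> to a Parseval sum of at most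
    9, hence \<open>144 = 16 * 9\<close>.\<close>
  have "real (card ?B) * (1 / 16) = (\<Sum>b\<in>?B. 1 / 16)" by simp
  also have "\<dots> \<le> (\<Sum>b\<in>?B. (norm (half_binom_fourier n a (int (k b) * int b0)))\<^sup>2)"
    by (intro sum_mono large)
  also have "\<dots> = (\<Sum>l\<in>k ` ?B. (norm (half_binom_fourier n a (int l * int b0)))\<^sup>2)"
    unfolding sum.reindex[OF inj] by (simp only: o_def)
  also have "\<dots> \<le> (\<Sum>l<a. (norm (half_binom_fourier n a (int l * int b0)))\<^sup>2)"
    using k by (intro sum_mono2) auto
  also have "\<dots> \<le> 9" by (rule half_binom_fourier_parseval_le[OF a b0 n(1)])
  finally show ?thesis by simp
qed

subsection \<open>The sample bound\<close>

lemma pbd_const: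
  assumes "v \<in> {0..1}"
  shows "pbd N (\<lambda>_. v) = binomial_pmf N v"
  unfolding pbd_def using assms by (intro binomial_pmf_altdef'[symmetric]) auto

lemma weighted_pbd_sum_0: "weighted_pbd_sum N b a (\<lambda>_. 0) (\<lambda>_. 0) = return_pmf 0"
proof -
  have "binomial_pmf N 0 = return_pmf 0" by (subst set_pmf_subset_singleton[symmetric]) simp
  then show ?thesis by (simp add: weighted_pbd_sum_def pbd_const bind_return_pmf)
qed

lemma weighted_pbd_sum_1:
  "weighted_pbd_sum N b a (\<lambda>_. 1) (\<lambda>_. 1) = return_pmf (int b * int N + int a * int N)"
proof -
  have "binomial_pmf N 1 = return_pmf N" by (subst set_pmf_subset_singleton[symmetric]) simp
  then show ?thesis by (simp add: weighted_pbd_sum_def pbd_const bind_return_pmf)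
qed

text \<open>Without samples the output law \<open>R\<close> is the same for every target, yet it
  would have to be close to two point masses at distance 1. The bound \<open>m \<ge> 1\<close> later
  absorbs additive constants.\<close>

lemma learns_imp_sample:
  assumes "amax \<ge> 2" "N \<ge> 1" "learns N amax (1 / 16) m A"
  shows "m \<ge> 1"
proof (rule ccontr)
  assume "\<not> m \<ge> 1"
  then have m: "m = 0" by simp
  define a where "a = largest_prime_le amax"
  have "a \<ge> 2" unfolding a_def by (intro prime_ge_2_nat prime_largest_prime_le assms)
  define z where "z = int 1 * int N + int a * int N"
  define R where "R = A (\<lambda>_. 0)"
  have "z > 0" using assms(2) by (simp add: z_def add_pos_nonneg)
  let ?E = "\<lambda>x. {H. dtv (return_pmf x) H \<le> 1 / 16}"
  have 0: "measure_pmf.prob R (?E 0) \<ge> 9 / 10"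
    using assms(3)[unfolded learns_def, rule_format, of 1 "\<lambda>_. 0" "\<lambda>_. 0"] \<open>a \<ge> 2\<close>
    by (simp add: m weighted_pbd_sum_0 R_def a_def bind_return_pmf Let_def)
  have 1: "measure_pmf.prob R (?E z) \<ge> 9 / 10"
    using assms(3)[unfolded learns_def, rule_format, of 1 "\<lambda>_. 1" "\<lambda>_. 1"] \<open>a \<ge> 2\<close>
    by (simp add: m weighted_pbd_sum_1 R_def a_def z_def bind_return_pmf Let_def)
  have "?E 0 \<inter> ?E z = {}"
  proof (rule ccontr)
    assume "?E 0 \<inter> ?E z \<noteq> {}"
    then have "dtv (return_pmf 0) (return_pmf z) \<le> 2 * (1 / 16)" by (blast intro: dtv_triangle)
    moreover have "1 \<le> dtv (return_pmf 0) (return_pmf z)"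
      using abs_prob_diff_le_dtv[of "return_pmf 0" "{0}" "return_pmf z"] \<open>z > 0\<close> by (simp add: measure_return_pmf)
    ultimately show False by simp
  qed
  then have "measure_pmf.prob R (?E 0 \<union> ?E z) = measure_pmf.prob R (?E 0) + measure_pmf.prob R (?E z)"
    by (intro measure_pmf.finite_measure_Union) auto
  then show False using 0 1 measure_pmf.prob_le_1[of R "?E 0 \<union> ?E z"] by linarith
qed

lemma learns_imp_power_ge:
  assumes "amax \<ge> 2" "a = largest_prime_le amax" "n = a\<^sup>2 div 16" "n \<le> N" "4 * n\<^sup>2 \<le> Suc N"
    and L: "learns N amax (1 / 16) m A"
  shows "9 / 10 * real (a - 1) \<le> 18 ^ m * 144"
proof -
  have a: "prime a" unfolding assms(2) by (intro prime_largest_prime_le assms)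
  obtain Q where Q: "\<And>b z. b \<in> {1..<a} \<Longrightarrow> pmf (hard_target N n a b) z \<le> 18 * pmf Q z"
    using ex_pmf_dominating_hard_targets[OF a assms(3-5)] by blast
  have "9 / 10 * real (card {1..<a}) \<le> 18 ^ m * real 144"
  proof (rule card_targets_le[where e = "1 / 16"])
    fix b assume b: "b \<in> {1..<a}"
    show "card {b'\<in>{1..<a}. dtv (hard_target N n a b') (hard_target N n a b) \<le> 2 * (1 / 16)} \<le> 144"
      by (rule card_close_hard_targets_le[OF a assms(3,4) b])
    show "9 / 10 \<le> measure_pmf.prob (Pi_pmf {..<m} 0 (\<lambda>_. hard_target N n a b) \<bind> A)
        {H. dtv (hard_target N n a b) H \<le> 1 / 16}"
      using L[unfolded learns_def Let_def, rule_format, of b "\<lambda>i. if i < n then 1 / 2 else 0"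
          "\<lambda>i. if i < N then 1 / 2 else 0"] b
      by (simp add: hard_target_def assms(2))
  qed (use Q in auto)
  then show ?thesis by simp
qed

theorem theorem65:
  shows "\<exists>eps0>0. \<exists>c>0. \<forall>amax::nat. amax \<ge> 2 \<longrightarrow> (\<exists>N0. \<forall>N\<ge>N0. \<forall>m A.
           learns N amax eps0 m A \<longrightarrow> real m \<ge> c * ln (real amax))"
proof -
  have "\<exists>N0. \<forall>N\<ge>N0. \<forall>m A. learns N amax (1 / 16) m A \<longrightarrow> real m \<ge> 1 / 34 * ln (real amax)"
    if amax: "amax \<ge> 2" for amax :: nat
  proof -
    define a where "a = largest_prime_le amax"
    define n where "n = a\<^sup>2 div 16"
    show ?thesis
    \<comment> \<open>The threshold ensures \<open>n \<le> N\<close>,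
      \<open>4 * n^2 \<le> Suc N\<close> and \<open>N \<ge> 1\<close> at once.\<close>
    proof (intro exI[of _ "n + 4 * n\<^sup>2 + 1"] allI impI)
      fix N m and A :: "(nat \<Rightarrow> int) \<Rightarrow> int pmf pmf"
      assume N: "n + 4 * n\<^sup>2 + 1 \<le> N" and L: "learns N amax (1 / 16) m A"
      have m1: "m \<ge> 1" using learns_imp_sample[OF amax _ L] N by simp
      have a2: "a \<ge> 2" unfolding a_def by (intro prime_ge_2_nat prime_largest_prime_le amax)
      have "9 / 10 * real (a - 1) \<le> 18 ^ m * 144"
        by (rule learns_imp_power_ge[OF amax a_def n_def _ _ L]) (use N in auto)
      moreover have "real (a - 1) \<ge> real a / 2" using a2 by (simp add: of_nat_diff)
      moreover have "sqrt (real amax) / 8 \<le> real a"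
        unfolding a_def by (rule largest_prime_le_ge_sqrt[OF amax])
      \<comment> \<open>The constant is \<open>144 * (10 / 9) * 2 * 8 = 2560\<close>.\<close>
      ultimately have "sqrt (real amax) \<le> 18 ^ m * 2560" by linarith
      then have "ln (sqrt (real amax)) \<le> ln (18 ^ m * 2560)" using amax by (subst ln_le_cancel_iff) auto
      also have "\<dots> = real m * ln 18 + ln 2560" by (simp add: ln_mult ln_realpow)
      finally have 1: "ln (real amax) / 2 \<le> real m * ln 18 + ln 2560" using amax by (simp add: ln_sqrt)
      have ln_le: "ln x \<le> real k" if "x > 0" "x \<le> 2 ^ k" for x :: real and k :: nat
      proof -
        have "ln x \<le> ln (2 ^ k)" using that by (subst ln_le_cancel_iff) auto
        also have "\<dots> = real k * ln 2" by (simp add: ln_realpow)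
        also have "\<dots> \<le> real k * 1" using ln_le_minus_one[of 2] by (intro mult_left_mono) auto
        finally show ?thesis by simp
      qed
      have "ln 18 \<le> (5 :: real)" using ln_le[of 18 5] by simp
      then have "real m * ln 18 \<le> real m * 5" by (intro mult_left_mono) auto
      moreover have "ln 2560 \<le> (12 :: real)" using ln_le[of 2560 12] by simp
      ultimately have "ln (real amax) \<le> 10 * real m + 24" using 1 by linarith
      \<comment> \<open>Here \<open>24 \<le> 24 * m\<close> because
        \<open>m \<ge> 1\<close>.\<close>
      then have "ln (real amax) \<le> 34 * real m" using m1 by linarith
      then show "real m \<ge> 1 / 34 * ln (real amax)" by simp
    qed
  qed
  moreover have "(1 / 16 :: real) > 0" "(1 / 34 :: real) > 0" by simp_all
  ultimately show ?thesis by blast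
qed

end
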